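(* Let $n\ge 2$ be an integer, let $\mu_1\ge\mu_2\ge\cdots\ge\mu_n>0$ be service rates, let $\mu^n=\sum_{i=1}^n\mu_i$, and let $\lambda$ be an arrival rate with $0<\lambda<\mu^n$. Consider the continuous-time Markov process of the $M\mid M\mid n$ queue with heterogeneous servers and uninformed customers, with arrival rate $\lambda$ and service rates $\mu_1,\dots,\mu_n$ (as defined in the context). Assume that this process is time homogeneous and irreducible, remains in each state for a positive length of time, and is incapable of passing through an infinite number of states in a finite time. For $j\in\{1,\dots,n\}$ let $\mathcal{P}_j^n$ denote the steady state probability that server $j$ is busy. Then for all $l,m\in\{1,\dots,n\}$ with $\mu_l>\mu_m$: (i) $\mathcal{P}_l^n<\mathcal{P}_m^n$; (ii) $\mu_l\,\mathcal{P}_l^n>\mu_m\,\mathcal{P}_m^n$; (iii) $\dfrac{\mu_m}{\mu_l}\,\mathcal{P}_m^n<\mathcal{P}_l^n<\mathcal{P}_m^n$.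
   Context: The $M\mid M\mid n$ queue with heterogeneous servers and uninformed customers is the following continuous-time Markov process. States: tuples $(x_1,\dots,x_n,x_f)$ with $x_1,\dots,x_n\in\{0,1\}$ and $x_f\in\{0,1,2,\dots\}$, subject to $x_f>0\Rightarrow x_1=\cdots=x_n=1$. Here $x_i=1$ if and only if server $i$ is busy, and $x_f$ is the number of customers waiting in the (common) queue. States are indexed by the integer $i=x_12^{n-1}+x_22^{n-2}+\cdots+x_n2^0+x_f\ge 0$. Thus the indices $0\le i\le 2^n-1$ correspond to the states with $x_f=0$, and for $i\ge 2^n-1$ the state $i$ is the one with all servers busy and $x_f=i-(2^n-1)$. Transitions: let $S_i^n\subseteq\{1,\dots,n\}$ be the set of busy servers in state $i$. - Arrivals occur at rate $\lambda$. If $|S_i^n|<n$, the arriving customer chooses one of the $n-|S_i^n|$ idle servers uniformly at random (customers do not know the service rates), so each transition making a given idle server busy has rate $\lambda/(n-|S_i^n|)$. If all servers are busy, the arriving customer joins the queue, so $x_f$ increases by $1$ at rate $\lambda$. - If $x_f=0$, each busy server $k$ becomes idle at rate $\mu_k$. If $x_f>0$, then $x_f$ decreases by $1$ at total rate $\mu^n=\sum_{k=1}^n\mu_k$ (a server that finishes immediately takes a customer from the queue). Steady state: $(p_i^n)_{i\ge 0}$ is the stationary probability distribution of this process, i.e. the solution of its balance equations with $\sum_{i\ge0}p_i^n=1$; in particular $\lambda p_{i-1}^n=\mu^n p_i^n$ for $i\ge 2^n$. The probability that server $j$ is busy is $\mathcal{P}_j^n=\sum_{i\ge 0:\ j\in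 S_i^n}p_i^n$, the sum being over all states in which server $j$ is busy, including those with a nonempty queue. The quantity $\mu_j\mathcal{P}_j^n$ is called the effective rate of service done by server $j$. *)

theory Defs
  imports "HOL-Probability.Probability"
begin

section \<open>Continuous-time Markov chains on a discrete state space\<close>

text \<open>
  Below, \<open>E\<close> is the state space, and \<open>q x y\<close> is the rate of the
  transition from \<open>x\<close> to a different state \<open>y\<close> (values \<open>q x x\<close> are ignored).
\<close>

definition exit_rate :: "'s set \<Rightarrow> ('s \<Rightarrow> 's \<Rightarrow> real) \<Rightarrow> 's \<Rightarrow> real" where
  "exit_rate E q x = (\<Sum>\<^sub>\<infinity>y\<in>E - {x}. q x y)"

definition generator :: "'s set \<Rightarrow> ('s \<Rightarrow> 's \<Rightarrow> real) \<Rightarrow> 's \<Rightarrow> 's \<Rightarrow> real" where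
  "generator E q x y = (if x = y then - exit_rate E q x else q x y)"

text \<open>\<open>P t x y\<close> is the probability of moving from \<open>x\<close> to \<open>y\<close> in time \<open>t\<close>.\<close>

definition transition_function :: "'s set \<Rightarrow> (real \<Rightarrow> 's \<Rightarrow> 's \<Rightarrow> real) \<Rightarrow> bool" where
  "transition_function E P \<longleftrightarrow>
     (\<forall>t\<ge>0. \<forall>x\<in>E. \<forall>y\<in>E. 0 \<le> P t x y) \<and>
     (\<forall>t\<ge>0. \<forall>x\<in>E. (P t x has_sum 1) E) \<and>
     (\<forall>x\<in>E. \<forall>y\<in>E. P 0 x y = (if x = y then 1 else 0)) \<and>
     (\<forall>s\<ge>0. \<forall>t\<ge>0. \<forall>x\<in>E. \<forall>y\<in>E. ((\<lambda>z. P s x z * P t z y) has_sum P (s + t) x y) E)"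

definition has_rates ::
    "'s set \<Rightarrow> ('s \<Rightarrow> 's \<Rightarrow> real) \<Rightarrow> (real \<Rightarrow> 's \<Rightarrow> 's \<Rightarrow> real) \<Rightarrow> bool" where
  "has_rates E q P \<longleftrightarrow>
     (\<forall>x\<in>E. \<forall>y\<in>E.
        ((\<lambda>t. P t x y) has_real_derivative generator E q x y) (at 0 within {0..}))"

text \<open>
  The last clause is the Markov property, with the conditional probability multiplied out so
  that conditioning on null events causes no trouble. Time homogeneity is the fact that the
  transition probability depends only on the length \<open>t (Suc k) - t k\<close> of the time interval.
\<close>

definition time_homogeneous_markov_process ::
    "'s set \<Rightarrow> (real \<Rightarrow> 's \<Rightarrow> 's \<Rightarrow> real) \<Rightarrow> 'w measure \<Rightarrow> (real \<Rightarrow> 'w \<Rightarrow> 's) \<Rightarrow> bool" where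
  "time_homogeneous_markov_process E P M X \<longleftrightarrow>
     prob_space M \<and>
     transition_function E P \<and>
     (\<forall>t\<ge>0. X t \<in> measurable M (count_space E)) \<and>
     (\<forall>(k::nat) (t::nat \<Rightarrow> real) (s::nat \<Rightarrow> 's).
        0 \<le> t 0 \<and> (\<forall>i\<le>k. t i < t (Suc i)) \<and> (\<forall>i\<le>Suc k. s i \<in> E) \<longrightarrow>
        measure M {\<omega>\<in>space M. \<forall>i\<le>Suc k. X (t i) \<omega> = s i} =
        measure M {\<omega>\<in>space M. \<forall>i\<le>k. X (t i) \<omega> = s i} * P (t (Suc k) - t k) (s k) (s (Suc k)))"

definition irreducible_transition_function ::
    "'s set \<Rightarrow> (real \<Rightarrow> 's \<Rightarrow> 's \<Rightarrow> real) \<Rightarrow> bool" where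
  "irreducible_transition_function E P \<longleftrightarrow> (\<forall>x\<in>E. \<forall>y\<in>E. \<exists>t\<ge>0. P t x y > 0)"

definition positive_sojourn_times :: "'w measure \<Rightarrow> (real \<Rightarrow> 'w \<Rightarrow> 's) \<Rightarrow> bool" where
  "positive_sojourn_times M X \<longleftrightarrow>
     (AE \<omega> in M. \<forall>t\<ge>0. \<exists>\<epsilon>>0. \<forall>s\<in>{t..<t + \<epsilon>}. X s \<omega> = X t \<omega>)"

definition jump_times :: "(real \<Rightarrow> 'w \<Rightarrow> 's) \<Rightarrow> 'w \<Rightarrow> real set" where
  "jump_times X \<omega> = {t. 0 < t \<and> \<not> (\<forall>\<^sub>F s in at t. X s \<omega> = X t \<omega>)}"

text \<open>
  States are counted with multiplicity: jumping infinitely often back and forth between two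
  states within a finite time is excluded as well.
\<close>

definition non_explosive :: "'w measure \<Rightarrow> (real \<Rightarrow> 'w \<Rightarrow> 's) \<Rightarrow> bool" where
  "non_explosive M X \<longleftrightarrow> (AE \<omega> in M. \<forall>T. finite (jump_times X \<omega> \<inter> {..T}))"

text \<open>Stationary probability distribution: normalised solution of the balance equations.\<close>

definition stationary_distribution :: "'s set \<Rightarrow> ('s \<Rightarrow> 's \<Rightarrow> real) \<Rightarrow> ('s \<Rightarrow> real) \<Rightarrow> bool" where
  "stationary_distribution E q p \<longleftrightarrow>
     (\<forall>x\<in>E. 0 \<le> p x) \<and> (p has_sum 1) E \<and>
     (\<forall>x\<in>E. p x * exit_rate E q x = (\<Sum>\<^sub>\<infinity>y\<in>E - {x}. p y * q y x))"


section \<open>The queue with heterogeneous servers and uninformed customers\<close>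

text \<open>
  A tuple \<open>(x\<^sub>1, \<dots>, x\<^sub>n, x\<^sub>f)\<close> is represented by the pair of the set of busy servers
  \<open>{i. x\<^sub>i = 1}\<close> and the number \<open>x\<^sub>f\<close> of waiting customers.
\<close>

type_synonym queue_state = "nat set \<times> nat"

definition queue_states :: "nat \<Rightarrow> queue_state set" where
  "queue_states n = {(S, f). S \<subseteq> {1..n} \<and> (f > 0 \<longrightarrow> S = {1..n})}"

definition total_service_rate :: "nat \<Rightarrow> (nat \<Rightarrow> real) \<Rightarrow> real" where
  "total_service_rate n \<mu> = (\<Sum>k=1..n. \<mu> k)"

fun arrival_transition :: "nat \<Rightarrow> real \<Rightarrow> queue_state \<Rightarrow> queue_state \<Rightarrow> real" where
  "arrival_transition n lam (S, f) (T, g) =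
     (if card S < n
      then (if g = f \<and> (\<exists>k\<in>{1..n} - S. T = insert k S) then lam / real (n - card S) else 0)
      else (if T = S \<and> g = f + 1 then lam else 0))"

fun service_transition :: "nat \<Rightarrow> (nat \<Rightarrow> real) \<Rightarrow> queue_state \<Rightarrow> queue_state \<Rightarrow> real" where
  "service_transition n \<mu> (S, f) (T, g) =
     (if f = 0
      then (\<Sum>k | k \<in> S \<and> T = S - {k} \<and> g = 0. \<mu> k)
      else (if T = S \<and> f = g + 1 then total_service_rate n \<mu> else 0))"

definition queue_rate ::
    "nat \<Rightarrow> real \<Rightarrow> (nat \<Rightarrow> real) \<Rightarrow> queue_state \<Rightarrow> queue_state \<Rightarrow> real" where
  "queue_rate n lam \<mu> x y = arrival_transition n lam x y + service_transition n \<mu> x y"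

definition busy_probability :: "nat \<Rightarrow> (queue_state \<Rightarrow> real) \<Rightarrow> nat \<Rightarrow> real" where
  "busy_probability n p j = (\<Sum>\<^sub>\<infinity>x\<in>{x \<in> queue_states n. j \<in> fst x}. p x)"

end

theory Submission
  imports Defs
begin

text \<open>
  As an arriving customer does not distinguish between idle servers, the chain satisfies
  Kolmogorov's criterion, with reversible measure
  \<open>\<pi>(S) = (n - |S|)! \<Prod>\<^bsub>k\<in>S\<^esub> \<lambda>/\<mu>\<^sub>k\<close> on the states without waiting customers. Detailed balance turns
  the balance equations into the statement that \<open>p/\<pi>\<close> is harmonic away from the state in which all
  servers are busy; by the maximum principle \<open>p/\<pi>\<close> is then constant, since the only boundary point
  is that state. Hence \<open>\<mu>\<^sub>l p(T \<union> {l}) = \<mu>\<^sub>m p(T \<union> {m})\<close> whenever \<open>l, m \<notin> T\<close>. The states in which both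
  \<open>l\<close> and \<open>m\<close> are busy contribute the same positive amount \<open>K\<close> to both busy probabilities, so these
  are \<open>K + D\<^sub>l\<close> and \<open>K + D\<^sub>m\<close> with \<open>\<mu>\<^sub>l D\<^sub>l = \<mu>\<^sub>m D\<^sub>m > 0\<close>, which gives all the inequalities.
\<close>

section \<open>Reversible measure and detailed balance\<close>

locale uninformed_queue =
  fixes n :: nat and lam :: real and \<mu> :: "nat \<Rightarrow> real"
  assumes lam_pos: "lam > 0"
    and mu_pos: "k \<in> {1..n} \<Longrightarrow> \<mu> k > 0"
    and n_pos: "n > 0"
begin

abbreviation E :: "queue_state set" where "E \<equiv> queue_states n"
abbreviation q :: "queue_state \<Rightarrow> queue_state \<Rightarrow> real" where "q \<equiv> queue_rate n lam \<mu>"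
abbreviation E0 :: "queue_state set" where "E0 \<equiv> Pow {1..n} \<times> {0}"

definition rev_measure :: "nat set \<Rightarrow> real" where
  "rev_measure S = fact (n - card S) * (\<Prod>k\<in>S. lam / \<mu> k)"

lemma rev_measure_pos:
  assumes "S \<subseteq> {1..n}" shows "rev_measure S > 0"
  unfolding rev_measure_def
  using assms lam_pos mu_pos by (intro mult_pos_pos prod_pos) (auto intro!: divide_pos_pos)

text \<open>Detailed balance for one server: admitting \<open>k\<close> removes the factor
  \<open>n - card S\<close> from the factorial and adds the factor \<open>lam / \<mu> k\<close> to
  the product.\<close>

lemma rev_measure_insert:
  assumes "S \<subseteq> {1..n}" "k \<in> {1..n}" "k \<notin> S"
  shows "rev_measure S * (lam / real (n - card S)) = rev_measure (insert k S) * \<mu> k"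
proof -
  have fin: "finite S" using assms(1) by (rule finite_subset) simp
  \<comment> \<open>This bound makes the truncated subtraction \<open>n - card S\<close> a genuine
    successor, so the factorial unfolds once.\<close>
  have "card (insert k S) \<le> card {1..n}"
    using assms by (intro card_mono) auto
  then have "n - card S = Suc (n - card (insert k S))" using fin assms by simp
  moreover have "\<mu> k > 0" using mu_pos assms by simp
  ultimately show ?thesis
    using fin assms unfolding rev_measure_def by (simp add: field_simps)
qed

lemma card_less_n:
  assumes "S \<subset> {1..n}" shows "card S < n"
  using psubset_card_mono[OF _ assms] by simp

text \<open>Arrivals are paired with services in the opposite direction: between empty-queue states
  both rates vanish unless \<open>T\<close> arises from \<open>S\<close> by adding one
  server.\<close>

lemma detailed_balance_aux:
  assumes "S \<subseteq> {1..n}" "T \<subseteq> {1..n}"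
  shows "rev_measure S * arrival_transition n lam (S, 0) (T, 0) =
         rev_measure T * service_transition n \<mu> (T, 0) (S, 0)"
proof (cases "\<exists>k\<in>{1..n} - S. T = insert k S")
  case True
  then obtain k where k: "k \<in> {1..n}" "k \<notin> S" and T: "T = insert k S" by blast
  have "{j. j \<in> T \<and> S = T - {j} \<and> 0 = (0::nat)} = {k}" using k T by auto
  then have "service_transition n \<mu> (T, 0) (S, 0) = \<mu> k" by simp
  moreover have "card S < n" using card_less_n[of S] assms(1) k by blast
  then have "arrival_transition n lam (S, 0) (T, 0) = lam / real (n - card S)"
    using True by simp
  ultimately show ?thesis using rev_measure_insert[OF assms(1) k] T by simp
next
  case False
  have none: "{k. k \<in> T \<and> S = T - {k} \<and> 0 = (0::nat)} = {}" using False assms by blast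
  have "service_transition n \<mu> (T, 0) (S, 0) = 0"
    unfolding service_transition.simps none by simp
  then show ?thesis using False by simp
qed

lemma detailed_balance:
  assumes "x \<in> E0" "y \<in> E0"
  shows "rev_measure (fst x) * q x y = rev_measure (fst y) * q y x"
  using assms detailed_balance_aux[of "fst x" "fst y"] detailed_balance_aux[of "fst y" "fst x"]
  by (auto simp: queue_rate_def distrib_left simp del: arrival_transition.simps
        service_transition.simps)

section \<open>Signs and support of the rates\<close>

lemma queue_rate_nonneg:
  assumes "x \<in> E" shows "q x y \<ge> 0"
proof -
  obtain S f T g where xy: "x = (S, f)" "y = (T, g)" by force
  then have S: "S \<subseteq> {1..n}" using assms by (auto simp: queue_states_def)
  have "arrival_transition n lam x y \<ge> 0" using xy lam_pos by auto
  moreover have "service_transition n \<mu> x y \<ge> 0"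
    using xy S by (auto simp: total_service_rate_def intro!: sum_nonneg less_imp_le[OF mu_pos])
  ultimately show ?thesis by (simp add: queue_rate_def)
qed

lemma queue_rate_insert_pos:
  assumes "S \<subseteq> {1..n}" "k \<in> {1..n}" "k \<notin> S"
  shows "q (S, 0) (insert k S, 0) > 0"
proof -
  have "S \<subset> {1..n}" using assms by blast
  then have "arrival_transition n lam (S, 0) (insert k S, 0) > 0"
    using assms card_less_n lam_pos by auto
  moreover have "service_transition n \<mu> (S, 0) (insert k S, 0) \<ge> 0"
    using assms by (auto intro!: sum_nonneg less_imp_le[OF mu_pos])
  ultimately show ?thesis by (simp add: queue_rate_def)
qed

lemma E0_subset: "E0 \<subseteq> E"
  by (auto simp: queue_states_def)

lemma E_minus_E0: "y \<in> E - E0 \<Longrightarrow> \<exists>f>0. y = ({1..n}, f)"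
  by (cases y) (auto simp: queue_states_def)

text \<open>Nonempty queues communicate with \<open>E0\<close> only through the state with all
  servers busy. At every other state of \<open>E0\<close> the infinite sums in the balance equation
  therefore become finite sums over \<open>E0\<close>.\<close>

lemma queue_rate_outside:
  assumes "S \<subset> {1..n}" "y \<in> E - E0"
  shows "q (S, 0) y = 0" "q y (S, 0) = 0"
proof -
  obtain f where "f > 0" "y = ({1..n}, f)" using E_minus_E0[OF assms(2)] by blast
  moreover have "S \<noteq> {1..n}" using assms(1) by blast
  ultimately show "q (S, 0) y = 0" "q y (S, 0) = 0"
    using card_less_n[OF assms(1)] by (simp_all add: queue_rate_def)
qed

text \<open>Bounds the inflow into a full state by finitely many sources. For \<open>f = 0\<close>
  the truncated \<open>f - 1\<close> adds only a state already in \<open>E0\<close>.\<close>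

lemma full_queue_rate_zero:
  assumes "y \<in> E" "y \<notin> E0 \<union> {({1..n}, f - 1), ({1..n}, f + 1)}"
  shows "q y ({1..n}, f) = 0"
proof -
  obtain g where "g > 0" "y = ({1..n}, g)" using E_minus_E0 assms by blast
  then show ?thesis using assms by (auto simp: queue_rate_def)
qed

end

section \<open>Constancy of the density on empty-queue states\<close>

locale stationary_uninformed_queue = uninformed_queue +
  fixes p :: "queue_state \<Rightarrow> real"
  assumes stationary: "stationary_distribution E q p"
begin

lemma p_nonneg: "x \<in> E \<Longrightarrow> p x \<ge> 0"
  and p_has_sum: "(p has_sum 1) E"
  and p_balance: "x \<in> E \<Longrightarrow> p x * exit_rate E q x = (\<Sum>\<^sub>\<infinity>y\<in>E - {x}. p y * q y x)"
  using stationary by (auto simp: stationary_distribution_def)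

definition ratio :: "queue_state \<Rightarrow> real" where
  "ratio x = p x / rev_measure (fst x)"

text \<open>Detailed balance turns inflow rates into outflow rates times the common factor
  \<open>rev_measure S\<close>, which cancels since it is positive.\<close>

lemma ratio_harmonic:
  assumes "S \<subset> {1..n}"
  shows "(\<Sum>y\<in>E0 - {(S, 0)}. q (S, 0) y * (ratio (S, 0) - ratio y)) = 0"
proof -
  let ?x = "(S, 0::nat)"
  let ?w = "\<lambda>y :: queue_state. rev_measure (fst y)"
  have x: "?x \<in> E0" using assms by auto
  have w_pos: "?w y > 0" if "y \<in> E0" for y using that by (intro rev_measure_pos) auto
  have "exit_rate E q ?x = (\<Sum>\<^sub>\<infinity>y\<in>E0 - {?x}. q ?x y)"
    unfolding exit_rate_def using E0_subset queue_rate_outside(1)[OF assms]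
    by (intro infsum_cong_neutral) auto
  then have exit: "exit_rate E q ?x = (\<Sum>y\<in>E0 - {?x}. q ?x y)" by simp
  have "(\<Sum>\<^sub>\<infinity>y\<in>E - {?x}. p y * q y ?x) = (\<Sum>\<^sub>\<infinity>y\<in>E0 - {?x}. p y * q y ?x)"
    using E0_subset queue_rate_outside(2)[OF assms]
    by (intro infsum_cong_neutral) auto
  also have "\<dots> = (\<Sum>y\<in>E0 - {?x}. p y * q y ?x)" by simp
  also have "\<dots> = (\<Sum>y\<in>E0 - {?x}. ?w ?x * (q ?x y * ratio y))"
  proof (rule sum.cong)
    fix y assume y: "y \<in> E0 - {?x}"
    have "p y * q y ?x = ratio y * (?w y * q y ?x)"
      using w_pos[of y] y by (simp add: ratio_def)
    also have "\<dots> = ratio y * (?w ?x * q ?x y)"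
      using detailed_balance[OF x, of y] y by simp
    finally show "p y * q y ?x = ?w ?x * (q ?x y * ratio y)" by simp
  qed simp
  finally have "p ?x * (\<Sum>y\<in>E0 - {?x}. q ?x y) = ?w ?x * (\<Sum>y\<in>E0 - {?x}. q ?x y * ratio y)"
    using p_balance[of ?x] x E0_subset exit by (auto simp: sum_distrib_left)
  moreover have "p ?x = ?w ?x * ratio ?x" using w_pos[OF x] by (simp add: ratio_def)
  ultimately have "ratio ?x * (\<Sum>y\<in>E0 - {?x}. q ?x y) = (\<Sum>y\<in>E0 - {?x}. q ?x y * ratio y)"
    using w_pos[OF x] by simp
  then show ?thesis
    by (simp add: sum_subtractf right_diff_distrib sum_distrib_left mult.commute)
qed

text \<open>The sign \<open>c\<close> serves to obtain the minimum principle as well.\<close>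

lemma maximum_principle:
  assumes "S \<subseteq> {1..n}"
  shows "c * ratio (S, 0) \<le> c * ratio ({1..n}, 0)"
proof -
  let ?h = "\<lambda>T. c * ratio (T, 0)"
  define m where "m = Max (?h ` Pow {1..n})"
  have le: "?h T \<le> m" if "T \<subseteq> {1..n}" for T
    unfolding m_def using that by (intro Max_ge) auto
  define \<M> where "\<M> = {T \<in> Pow {1..n}. ?h T = m}"
  have "m \<in> ?h ` Pow {1..n}" unfolding m_def by (intro Max_in) auto
  then have "\<M> \<noteq> {}" unfolding \<M>_def by blast
  moreover have "finite \<M>" unfolding \<M>_def by simp
  \<comment> \<open>Among the maximisers, an inclusion-maximal one is chosen, so that a single
    arrival yields a contradiction.\<close>
  ultimately obtain T where T: "T \<in> \<M>" and T_max: "\<And>U. U \<in> \<M> \<Longrightarrow> T \<subseteq> U \<Longrightarrow> U = T"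
    using finite_has_maximal[of \<M>] by metis
  have "T = {1..n}"
  proof (rule ccontr)
    assume "T \<noteq> {1..n}"
    then have proper: "T \<subset> {1..n}" using T by (auto simp: \<M>_def)
    then obtain k where k: "k \<in> {1..n}" "k \<notin> T" by blast
    let ?x = "(T, 0::nat)"
    let ?f = "\<lambda>y. q ?x y * (m - c * ratio y)"
    have hT: "c * ratio ?x = m" using T by (auto simp: \<M>_def)
    have "(\<Sum>y\<in>E0 - {?x}. ?f y) = c * (\<Sum>y\<in>E0 - {?x}. q ?x y * (ratio ?x - ratio y))"
      unfolding hT[symmetric] sum_distrib_left by (intro sum.cong) (auto simp: algebra_simps)
    then have sum0: "(\<Sum>y\<in>E0 - {?x}. ?f y) = 0" using ratio_harmonic[OF proper] by simp
    have nonneg: "?f y \<ge> 0" if "y \<in> E0 - {?x}" for y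
      using that le E0_subset proper
      by (intro mult_nonneg_nonneg queue_rate_nonneg) auto
    \<comment> \<open>Nonnegative terms with sum zero all vanish; as the rate to
      \<open>insert k T\<close> is positive, that state is a maximiser too.\<close>
    have "?f (insert k T, 0) = 0"
      using sum_nonneg_0[OF _ nonneg sum0, of "(insert k T, 0)"] k proper by auto
    then have "insert k T \<in> \<M>"
      using queue_rate_insert_pos[of T k] k proper by (auto simp: \<M>_def)
    then show False using T_max[of "insert k T"] k by blast
  qed
  then show ?thesis using T le[OF assms] by (auto simp: \<M>_def)
qed

lemma p_eq_rev_measure:
  assumes "S \<subseteq> {1..n}"
  shows "p (S, 0) = ratio ({1..n}, 0) * rev_measure S"
proof -
  \<comment> \<open>The signs 1 and -1 give the two inequalities.\<close>
  have "ratio (S, 0) = ratio ({1..n}, 0)"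
    using maximum_principle[OF assms, of 1] maximum_principle[OF assms, of "-1"] by simp
  then show ?thesis
    using rev_measure_pos[OF assms] by (auto simp: ratio_def field_simps)
qed

section \<open>Positivity of the stationary distribution\<close>

lemma p_full_Suc_zero:
  assumes "p ({1..n}, f) = 0"
  shows "p ({1..n}, Suc f) = 0"
proof -
  let ?x = "({1..n}, f)" and ?y = "({1..n}, Suc f)"
  let ?g = "\<lambda>y. p y * q y ?x"
  have x: "?x \<in> E" and y: "?y \<in> E" by (auto simp: queue_states_def)
  \<comment> \<open>Summability has to be secured first: \<open>infsum\<close> defaults to 0
    otherwise, and a zero value would say nothing about the terms.\<close>
  have "?g summable_on (E - {?x}) \<inter> (E0 \<union> {({1..n}, f - 1), ({1..n}, f + 1)})"
    by (intro summable_on_finite) auto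
  also have "?this \<longleftrightarrow> ?g summable_on (E - {?x})"
    using full_queue_rate_zero by (intro summable_on_cong_neutral) auto
  finally have summable: "?g summable_on (E - {?x})" .
  \<comment> \<open>Without mass at \<open>?x\<close> its outflow is zero, hence so is each
    nonnegative inflow term.\<close>
  have "?g ?y = 0"
  proof (rule nonneg_infsum_le_0D[OF _ summable])
    show "infsum ?g (E - {?x}) \<le> 0" using p_balance[OF x] assms by simp
  qed (use y p_nonneg queue_rate_nonneg in auto)
  moreover have "q ?y ?x > 0"
    using mu_pos n_pos by (auto simp: queue_rate_def total_service_rate_def intro!: sum_pos)
  ultimately show ?thesis by simp
qed

text \<open>A zero here would spread to all longer queues by induction and to all of
  \<open>E0\<close> by constancy of the density, contradicting total mass 1.\<close>

lemma p_full_pos: "p ({1..n}, 0) > 0"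
proof (rule ccontr)
  assume "\<not> p ({1..n}, 0) > 0"
  moreover have "p ({1..n}, 0) \<ge> 0" by (intro p_nonneg) (auto simp: queue_states_def)
  ultimately have p0: "p ({1..n}, 0) = 0" by simp
  have full: "p ({1..n}, f) = 0" for f
    by (induction f) (use p0 p_full_Suc_zero in auto)
  have "p x = 0" if "x \<in> E" for x
  proof (cases "x \<in> E0")
    case True
    then show ?thesis using p_eq_rev_measure[of "fst x"] p0 by (auto simp: ratio_def)
  next
    case False
    then show ?thesis using E_minus_E0[of x] that full by auto
  qed
  then have "(p has_sum 0) E" using has_sum_0 by blast
  then show False using p_has_sum has_sum_unique by fastforce
qed

lemma p_empty_queue_pos:
  assumes "S \<subseteq> {1..n}" shows "p (S, 0) > 0"
  using assms p_full_pos rev_measure_pos p_eq_rev_measure[OF assms] rev_measure_pos[of "{1..n}"]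
  by (simp add: ratio_def)

section \<open>Comparison of busy probabilities\<close>

lemma service_rate_exchange:
  assumes "S \<subseteq> {1..n} - {l, m}" "l \<in> {1..n}" "m \<in> {1..n}"
  shows "\<mu> l * p (insert l S, 0) = \<mu> m * p (insert m S, 0)"
proof -
  \<comment> \<open>Both sides equal \<open>rev_measure S * (lam / real (n - card S))\<close>: the
    arrival rate does not depend on which idle server is chosen.\<close>
  have "rev_measure (insert l S) * \<mu> l = rev_measure (insert m S) * \<mu> m"
    using assms by (subst (1 2) rev_measure_insert[symmetric]) auto
  then show ?thesis
    using assms by (subst (1 2) p_eq_rev_measure) (auto simp: mult_ac)
qed

text \<open>For distinct servers this is the probability that \<open>l\<close> is busy and
  \<open>m\<close> idle. An idle server forces an empty queue, so a finite sum suffices.\<close>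

definition exclusive_busy :: "nat \<Rightarrow> nat \<Rightarrow> real" where
  "exclusive_busy l m = (\<Sum>S\<in>Pow ({1..n} - {l, m}). p (insert l S, 0))"

definition jointly_busy :: "nat \<Rightarrow> nat \<Rightarrow> real" where
  "jointly_busy l m = (\<Sum>\<^sub>\<infinity>x\<in>{x \<in> E. l \<in> fst x \<and> m \<in> fst x}. p x)"

lemma p_summable: "A \<subseteq> E \<Longrightarrow> p summable_on A"
  using p_has_sum summable_on_subset_banach has_sum_imp_summable by blast

lemma busy_probability_split:
  assumes "l \<in> {1..n}" "m \<in> {1..n}" "l \<noteq> m"
  shows "busy_probability n p l = jointly_busy l m + exclusive_busy l m"
proof -
  let ?A = "{x \<in> E. l \<in> fst x \<and> m \<in> fst x}" and ?D = "{x \<in> E. l \<in> fst x \<and> m \<notin> fst x}"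
  let ?i = "\<lambda>S. (insert l S, 0::nat)"
  have "{x \<in> E. l \<in> fst x} = ?A \<union> ?D" by auto
  then have "busy_probability n p l = jointly_busy l m + infsum p ?D"
    unfolding busy_probability_def jointly_busy_def
    by (simp only:) (intro infsum_Un_disjoint p_summable, auto)
  moreover have "?D = ?i ` Pow ({1..n} - {l, m})"
  proof (intro equalityI subsetI)
    fix x assume x: "x \<in> ?D"
    then have "x = ?i (fst x - {l})" "fst x - {l} \<subseteq> {1..n} - {l, m}"
      using assms by (cases x; auto simp: queue_states_def)+
    then show "x \<in> ?i ` Pow ({1..n} - {l, m})" by blast
  qed (use assms in \<open>auto simp: queue_states_def\<close>)
  moreover have "inj_on ?i (Pow ({1..n} - {l, m}))"
    by (rule inj_onI) blast
  ultimately show ?thesis by (simp add: exclusive_busy_def sum.reindex)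
qed

lemma jointly_busy_pos:
  assumes "l \<in> {1..n}" "m \<in> {1..n}"
  shows "jointly_busy l m > 0"
proof -
  have "sum p {({1..n}, 0)} \<le> jointly_busy l m"
    unfolding jointly_busy_def using assms p_nonneg
    by (intro finite_sum_le_infsum p_summable) (auto simp: queue_states_def)
  then show ?thesis using p_full_pos by simp
qed

lemma exclusive_busy_pos:
  assumes "l \<in> {1..n}" shows "exclusive_busy l m > 0"
  unfolding exclusive_busy_def using assms
  by (intro sum_pos p_empty_queue_pos) auto

lemma exclusive_busy_exchange:
  assumes "l \<in> {1..n}" "m \<in> {1..n}"
  shows "\<mu> l * exclusive_busy l m = \<mu> m * exclusive_busy m l"
  unfolding exclusive_busy_def sum_distrib_left
  using assms by (intro sum.cong service_rate_exchange) auto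

lemma busy_probability_compare:
  assumes lm: "l \<in> {1..n}" "m \<in> {1..n}" and less: "\<mu> m < \<mu> l"
  shows "busy_probability n p l < busy_probability n p m"
    and "\<mu> m * busy_probability n p m < \<mu> l * busy_probability n p l"
proof -
  have "l \<noteq> m" using less by auto
  note split = busy_probability_split[OF lm this] busy_probability_split[OF lm(2,1) this[symmetric]]
  have joint: "jointly_busy m l = jointly_busy l m"
    unfolding jointly_busy_def by (intro infsum_cong_neutral) auto
  note ex = exclusive_busy_exchange[OF lm]
  \<comment> \<open>The joint parts agree, so the busy probabilities are ordered by their exclusive
    parts.\<close>
  have "\<mu> m * exclusive_busy l m < \<mu> l * exclusive_busy l m"
    using less exclusive_busy_pos[OF lm(1)] by simp
  then have "exclusive_busy l m < exclusive_busy m l"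
    using ex mu_pos[OF lm(2)] by simp
  then show "busy_probability n p l < busy_probability n p m"
    using split joint by simp
  \<comment> \<open>After weighting by service rates the exclusive parts agree, so now the joint
    part decides.\<close>
  have "\<mu> m * jointly_busy l m < \<mu> l * jointly_busy l m"
    using less jointly_busy_pos[OF lm] by simp
  then show "\<mu> m * busy_probability n p m < \<mu> l * busy_probability n p l"
    using split joint ex by (simp add: distrib_left)
qed

end

theorem theorem2p1:
  fixes n :: nat and \<mu> :: "nat \<Rightarrow> real" and lam :: real
    and M :: "'w measure" and X :: "real \<Rightarrow> 'w \<Rightarrow> queue_state"
    and P :: "real \<Rightarrow> queue_state \<Rightarrow> queue_state \<Rightarrow> real"
    and p :: "queue_state \<Rightarrow> real"
  assumes "n \<ge> 2"
    and "antimono_on {1..n} \<mu>"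
    and "\<mu> n > 0"
    and "0 < lam" and "lam < total_service_rate n \<mu>"
    and "time_homogeneous_markov_process (queue_states n) P M X"
    and "has_rates (queue_states n) (queue_rate n lam \<mu>) P"
    and "irreducible_transition_function (queue_states n) P"
    and "positive_sojourn_times M X"
    and "non_explosive M X"
    and "stationary_distribution (queue_states n) (queue_rate n lam \<mu>) p"
  shows "\<forall>l\<in>{1..n}. \<forall>m\<in>{1..n}. \<mu> l > \<mu> m \<longrightarrow>
           busy_probability n p l < busy_probability n p m \<and>
           \<mu> l * busy_probability n p l > \<mu> m * busy_probability n p m \<and>
           \<mu> m / \<mu> l * busy_probability n p m < busy_probability n p l \<and>
           busy_probability n p l < busy_probability n p m"
proof (intro ballI impI)
  fix l m assume lm: "l \<in> {1..n}" "m \<in> {1..n}" and less: "\<mu> m < \<mu> l"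
  have pos: "\<mu> k > 0" if "k \<in> {1..n}" for k
  proof -
    \<comment> \<open>The rates decrease weakly, so the last one bounds all others from
      below.\<close>
    have "\<mu> n \<le> \<mu> k" using monotone_onD[OF assms(2), of k n] that assms(1) by simp
    then show ?thesis using assms(3) by simp
  qed
  interpret stationary_uninformed_queue n lam \<mu> p
    using assms(1,4,11) pos by unfold_locales auto
  note cmp = busy_probability_compare[OF lm less]
  have "\<mu> m / \<mu> l * busy_probability n p m < busy_probability n p l"
    using cmp(2) pos[OF lm(1)] by (simp add: field_simps)
  then show "busy_probability n p l < busy_probability n p m \<and>
      \<mu> l * busy_probability n p l > \<mu> m * busy_probability n p m \<and>
      \<mu> m / \<mu> l * busy_probability n p m < busy_probability n p l \<and>
      busy_probability n p l < busy_probability n p m"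
    using cmp by simp
qed

end
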